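(* Every c3dp-algebra is isomorphic to a contract algebra; that is, for every c3dp-algebra $\mathbf{A}$ there is a Boolean algebra $\mathbf{B}$ such that $\mathbf{A}$ is isomorphic (as a c3dp-algebra) to the contract algebra $\mathbf{C(B)}$ on $\mathbf{B}$.
   Context: A dp-algebra (double p-algebra) is an algebra $(A;\wedge,\vee,\neg,D,0,1)$ of type $(2,2,1,1,0,0)$ such that $(A;\wedge,\vee,0,1)$ is a bounded distributive lattice; for every $a\in A$, $\neg a$ is the greatest $b\in A$ with $a\wedge b=0$; and for every $a\in A$, $Da$ is the smallest $b\in A$ with $a\vee b=1$. It is regular if $a\wedge Da\le b\vee\neg b$ for all $a,b\in A$. A three-valued dp-algebra is a regular dp-algebra satisfying $\neg x\vee\neg\neg x=1$ and $Dx\wedge DDx=0$. A c3dp-algebra (centred three-valued dp-algebra) is an algebra $(A;\wedge,\vee,\neg,D,0,c,1)$ such that $(A;\wedge,\vee,\neg,D,0,1)$ is a three-valued dp-algebra and the constant $c$ satisfies $\neg c=0$ and $Dc=1$. For a Boolean algebra $\mathbf{B} = (B;\cap,\cup,',0,1)$, the contract algebra on $\mathbf{B}$ is $\mathbf{C(B)} = (C(B);\wedge,\vee,\neg,D,\bot,\gamma,\top)$ with universe $C(B) = \{(a,b) \in B\times B : a \cup b = 1\}$ and operations $(a,b)\wedge(c,d) = (a\cup c, b\cap d)$, $(a,b)\vee(c,d) = (a\cap c, b\cup d)$, $\neg(a,b) = (b,b')$, $D(a,b) = (a',a)$, $\bot = (1,0)$, $\gamma = (1,1)$, $\top=(0,1)$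 (with $\bot,\gamma,\top$ interpreting $0,c,1$). *)

theory Defs
  imports "HOL-Algebra.Congruence"
begin

text \<open>
  All algebras carry an explicit universe \<open>carrier\<close>, in the style of HOL-Algebra, so that one can
  assert the existence of a Boolean algebra (whose universe may be a proper subset of a type)
  inside a formula.  Outside the carrier the operations are unconstrained.
\<close>

record 'a lattice_alg = "'a partial_object" +
  meet_op :: "'a \<Rightarrow> 'a \<Rightarrow> 'a"  (infixl "\<curlywedge>\<index>" 70)
  join_op :: "'a \<Rightarrow> 'a \<Rightarrow> 'a"  (infixl "\<curlyvee>\<index>" 65)
  zero_el :: 'a
  one_el :: 'a

definition le_op :: "('a, 'm) lattice_alg_scheme \<Rightarrow> 'a \<Rightarrow> 'a \<Rightarrow> bool"  (infix "\<preceq>\<index>" 50)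
  where "x \<preceq>\<^bsub>L\<^esub> y \<longleftrightarrow> x \<curlywedge>\<^bsub>L\<^esub> y = x"

locale bounded_distributive_lattice_alg =
  fixes L :: "('a, 'm) lattice_alg_scheme" (structure)
  assumes meet_closed: "\<lbrakk>x \<in> carrier L; y \<in> carrier L\<rbrakk> \<Longrightarrow> x \<curlywedge> y \<in> carrier L"
    and join_closed: "\<lbrakk>x \<in> carrier L; y \<in> carrier L\<rbrakk> \<Longrightarrow> x \<curlyvee> y \<in> carrier L"
    and zero_closed: "zero_el L \<in> carrier L"
    and one_closed: "one_el L \<in> carrier L"
    and meet_assoc: "\<lbrakk>x \<in> carrier L; y \<in> carrier L; z \<in> carrier L\<rbrakk>
      \<Longrightarrow> (x \<curlywedge> y) \<curlywedge> z = x \<curlywedge> (y \<curlywedge> z)"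
    and join_assoc: "\<lbrakk>x \<in> carrier L; y \<in> carrier L; z \<in> carrier L\<rbrakk>
      \<Longrightarrow> (x \<curlyvee> y) \<curlyvee> z = x \<curlyvee> (y \<curlyvee> z)"
    and meet_comm: "\<lbrakk>x \<in> carrier L; y \<in> carrier L\<rbrakk> \<Longrightarrow> x \<curlywedge> y = y \<curlywedge> x"
    and join_comm: "\<lbrakk>x \<in> carrier L; y \<in> carrier L\<rbrakk> \<Longrightarrow> x \<curlyvee> y = y \<curlyvee> x"
    and meet_absorb: "\<lbrakk>x \<in> carrier L; y \<in> carrier L\<rbrakk> \<Longrightarrow> x \<curlywedge> (x \<curlyvee> y) = x"
    and join_absorb: "\<lbrakk>x \<in> carrier L; y \<in> carrier L\<rbrakk> \<Longrightarrow> x \<curlyvee> (x \<curlywedge> y) = x"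
    and meet_distrib: "\<lbrakk>x \<in> carrier L; y \<in> carrier L; z \<in> carrier L\<rbrakk>
      \<Longrightarrow> x \<curlywedge> (y \<curlyvee> z) = (x \<curlywedge> y) \<curlyvee> (x \<curlywedge> z)"
    and zero_least: "x \<in> carrier L \<Longrightarrow> zero_el L \<preceq> x"
    and one_greatest: "x \<in> carrier L \<Longrightarrow> x \<preceq> one_el L"

record 'a bool_alg = "'a lattice_alg" +
  compl_op :: "'a \<Rightarrow> 'a"

locale boolean_alg = bounded_distributive_lattice_alg B
  for B :: "('a, 'm) bool_alg_scheme" (structure) +
  assumes compl_closed: "x \<in> carrier B \<Longrightarrow> compl_op B x \<in> carrier B"
    and meet_compl: "x \<in> carrier B \<Longrightarrow> x \<curlywedge> compl_op B x = zero_el B"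
    and join_compl: "x \<in> carrier B \<Longrightarrow> x \<curlyvee> compl_op B x = one_el B"

text \<open>The carrier-based notion agrees with the library class on full types.\<close>

lemma boolean_alg_UNIV:
  "boolean_alg \<lparr>carrier = (UNIV :: 'a::boolean_algebra set), meet_op = inf, join_op = sup,
     zero_el = bot, one_el = top, compl_op = uminus\<rparr>"
  by unfold_locales
    (simp_all add: le_op_def inf_aci sup_aci inf_sup_distrib1)

record 'a dp_alg = "'a lattice_alg" +
  neg_op :: "'a \<Rightarrow> 'a"
  dual_neg_op :: "'a \<Rightarrow> 'a"

locale dp_algebra = bounded_distributive_lattice_alg A
  for A :: "('a, 'm) dp_alg_scheme" (structure) +
  assumes neg_closed: "a \<in> carrier A \<Longrightarrow> neg_op A a \<in> carrier A"
    and meet_neg: "a \<in> carrier A \<Longrightarrow> a \<curlywedge> neg_op A a = zero_el A"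
    and neg_greatest: "\<lbrakk>a \<in> carrier A; b \<in> carrier A; a \<curlywedge> b = zero_el A\<rbrakk> \<Longrightarrow> b \<preceq> neg_op A a"
    and dual_neg_closed: "a \<in> carrier A \<Longrightarrow> dual_neg_op A a \<in> carrier A"
    and join_dual_neg: "a \<in> carrier A \<Longrightarrow> a \<curlyvee> dual_neg_op A a = one_el A"
    and dual_neg_least: "\<lbrakk>a \<in> carrier A; b \<in> carrier A; a \<curlyvee> b = one_el A\<rbrakk>
      \<Longrightarrow> dual_neg_op A a \<preceq> b"

locale regular_dp_algebra = dp_algebra +
  assumes regular: "\<lbrakk>a \<in> carrier A; b \<in> carrier A\<rbrakk>
    \<Longrightarrow> a \<curlywedge> dual_neg_op A a \<preceq> b \<curlyvee> neg_op A b"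

locale three_valued_dp_algebra = regular_dp_algebra +
  assumes stone: "x \<in> carrier A \<Longrightarrow> neg_op A x \<curlyvee> neg_op A (neg_op A x) = one_el A"
    and dual_stone: "x \<in> carrier A
      \<Longrightarrow> dual_neg_op A x \<curlywedge> dual_neg_op A (dual_neg_op A x) = zero_el A"

record 'a c3dp_alg = "'a dp_alg" +
  centre_el :: 'a

locale c3dp_algebra = three_valued_dp_algebra A
  for A :: "('a, 'm) c3dp_alg_scheme" (structure) +
  assumes centre_closed: "centre_el A \<in> carrier A"
    and neg_centre: "neg_op A (centre_el A) = zero_el A"
    and dual_neg_centre: "dual_neg_op A (centre_el A) = one_el A"

definition contract_algebra :: "('a, 'm) bool_alg_scheme \<Rightarrow> ('a \<times> 'a) c3dp_alg" where
  "contract_algebra B =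
    \<lparr>carrier = {(a, b). a \<in> carrier B \<and> b \<in> carrier B \<and> a \<curlyvee>\<^bsub>B\<^esub> b = one_el B},
     meet_op = (\<lambda>(a, b) (c, d). (a \<curlyvee>\<^bsub>B\<^esub> c, b \<curlywedge>\<^bsub>B\<^esub> d)),
     join_op = (\<lambda>(a, b) (c, d). (a \<curlywedge>\<^bsub>B\<^esub> c, b \<curlyvee>\<^bsub>B\<^esub> d)),
     zero_el = (one_el B, zero_el B),
     one_el = (zero_el B, one_el B),
     neg_op = (\<lambda>(a, b). (b, compl_op B b)),
     dual_neg_op = (\<lambda>(a, b). (compl_op B a, a)),
     centre_el = (one_el B, one_el B)\<rparr>"

definition c3dp_iso ::
    "('a, 'm) c3dp_alg_scheme \<Rightarrow> ('b, 'n) c3dp_alg_scheme \<Rightarrow> ('a \<Rightarrow> 'b) set" where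
  "c3dp_iso A C = {h. bij_betw h (carrier A) (carrier C) \<and>
     (\<forall>x\<in>carrier A. \<forall>y\<in>carrier A. h (x \<curlywedge>\<^bsub>A\<^esub> y) = h x \<curlywedge>\<^bsub>C\<^esub> h y) \<and>
     (\<forall>x\<in>carrier A. \<forall>y\<in>carrier A. h (x \<curlyvee>\<^bsub>A\<^esub> y) = h x \<curlyvee>\<^bsub>C\<^esub> h y) \<and>
     (\<forall>x\<in>carrier A. h (neg_op A x) = neg_op C (h x)) \<and>
     (\<forall>x\<in>carrier A. h (dual_neg_op A x) = dual_neg_op C (h x)) \<and>
     h (zero_el A) = zero_el C \<and>
     h (centre_el A) = centre_el C \<and>
     h (one_el A) = one_el C}"

definition c3dp_isomorphic ::
    "('a, 'm) c3dp_alg_scheme \<Rightarrow> ('b, 'n) c3dp_alg_scheme \<Rightarrow> bool" where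
  "c3dp_isomorphic A C \<longleftrightarrow> (\<exists>h. h \<in> c3dp_iso A C)"

end

theory Submission
  imports Defs
begin

text \<open>
  The complemented elements of \<open>A\<close> form a Boolean algebra \<open>B\<close>, and \<open>x \<mapsto> (D x, \<not>\<not>x)\<close> maps \<open>A\<close> to
  the contract algebra on \<open>B\<close>.  The two Stone identities make it a homomorphism, and regularity
  makes it injective.  A contract \<open>(a, b)\<close> is the image of \<open>b \<and> (\<not>a \<or> c)\<close>: the centre \<open>c\<close> is invisible
  to \<open>\<not>\<not>\<close> in a meet (\<open>\<not>\<not>c = 1\<close>) and to \<open>D\<close> in a join (\<open>D c = 1\<close>).
\<close>

section \<open>Order and lattice laws in bounded distributive lattices\<close>

context bounded_distributive_lattice_alg
begin

lemma le_antisym: "\<lbrakk>x \<preceq> y; y \<preceq> x; x \<in> carrier L; y \<in> carrier L\<rbrakk> \<Longrightarrow> x = y"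
  unfolding le_op_def by (metis meet_comm)

lemma le_trans:
  "\<lbrakk>x \<preceq> y; y \<preceq> z; x \<in> carrier L; y \<in> carrier L; z \<in> carrier L\<rbrakk> \<Longrightarrow> x \<preceq> z"
  unfolding le_op_def by (metis meet_assoc)

lemma le_iff_join: "\<lbrakk>x \<in> carrier L; y \<in> carrier L\<rbrakk> \<Longrightarrow> x \<preceq> y \<longleftrightarrow> x \<curlyvee> y = y"
  unfolding le_op_def by (metis join_absorb join_comm meet_absorb meet_comm)

lemma meet_le1: "\<lbrakk>x \<in> carrier L; y \<in> carrier L\<rbrakk> \<Longrightarrow> x \<curlywedge> y \<preceq> x"
  by (metis join_absorb join_comm le_iff_join meet_closed)

lemma meet_le2: "\<lbrakk>x \<in> carrier L; y \<in> carrier L\<rbrakk> \<Longrightarrow> x \<curlywedge> y \<preceq> y"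
  by (metis meet_comm meet_le1)

lemma join_ge1: "\<lbrakk>x \<in> carrier L; y \<in> carrier L\<rbrakk> \<Longrightarrow> x \<preceq> x \<curlyvee> y"
  unfolding le_op_def by (rule meet_absorb)

lemma join_ge2: "\<lbrakk>x \<in> carrier L; y \<in> carrier L\<rbrakk> \<Longrightarrow> y \<preceq> x \<curlyvee> y"
  by (metis join_comm join_ge1)

lemma le_meetI:
  "\<lbrakk>z \<preceq> x; z \<preceq> y; x \<in> carrier L; y \<in> carrier L; z \<in> carrier L\<rbrakk> \<Longrightarrow> z \<preceq> x \<curlywedge> y"
  unfolding le_op_def by (metis meet_assoc)

lemma join_leI:
  "\<lbrakk>x \<preceq> z; y \<preceq> z; x \<in> carrier L; y \<in> carrier L; z \<in> carrier L\<rbrakk> \<Longrightarrow> x \<curlyvee> y \<preceq> z"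
  by (metis join_assoc join_closed le_iff_join)

lemma meet_one: "x \<in> carrier L \<Longrightarrow> x \<curlywedge> one_el L = x"
  using one_greatest by (simp add: le_op_def)

lemma zero_join: "x \<in> carrier L \<Longrightarrow> zero_el L \<curlyvee> x = x"
  using zero_least zero_closed by (simp add: le_iff_join)

lemma meet_zero: "x \<in> carrier L \<Longrightarrow> x \<curlywedge> zero_el L = zero_el L"
  using zero_least zero_closed by (metis le_op_def meet_comm)

lemma join_one: "x \<in> carrier L \<Longrightarrow> x \<curlyvee> one_el L = one_el L"
  using one_greatest one_closed by (simp add: le_iff_join)

lemma join_zero: "x \<in> carrier L \<Longrightarrow> x \<curlyvee> zero_el L = x"
  using zero_join join_comm zero_closed by metis

text \<open>The other distributive law, derived so that the order dual is again a distributive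
  lattice; \<open>three_valued_dual\<close> relies on it.\<close>

lemma join_distrib:
  assumes "x \<in> carrier L" "y \<in> carrier L" "z \<in> carrier L"
  shows "x \<curlyvee> (y \<curlywedge> z) = (x \<curlyvee> y) \<curlywedge> (x \<curlyvee> z)"
proof -
  have "(x \<curlyvee> y) \<curlywedge> (x \<curlyvee> z) = ((x \<curlyvee> y) \<curlywedge> x) \<curlyvee> ((x \<curlyvee> y) \<curlywedge> z)"
    using assms by (simp add: meet_distrib join_closed)
  also have "(x \<curlyvee> y) \<curlywedge> x = x"
    using assms by (metis join_closed meet_absorb meet_comm)
  also have "(x \<curlyvee> y) \<curlywedge> z = (z \<curlywedge> x) \<curlyvee> (z \<curlywedge> y)"
    using assms by (metis join_closed meet_comm meet_distrib)
  also have "x \<curlyvee> ((z \<curlywedge> x) \<curlyvee> (z \<curlywedge> y)) = x \<curlyvee> (z \<curlywedge> y)"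
    using assms by (metis join_absorb join_assoc meet_closed meet_comm)
  finally show ?thesis
    using assms by (simp add: meet_comm)
qed

end

text \<open>The order dual. Since it swaps the two negations, facts about \<open>neg_op\<close> turn
  into facts about \<open>dual_neg_op\<close>.\<close>

definition dual_alg :: "('a, 'm) dp_alg_scheme \<Rightarrow> 'a dp_alg" where
  "dual_alg A =
    \<lparr>carrier = carrier A, meet_op = join_op A, join_op = meet_op A,
     zero_el = one_el A, one_el = zero_el A,
     neg_op = dual_neg_op A, dual_neg_op = neg_op A\<rparr>"

text \<open>One equation suffices: \<open>meet_neg\<close> supplies the other half, and any
  complement of x must be \<open>neg_op A x\<close> by \<open>complementedI\<close>.\<close>

definition complemented :: "('a, 'm) dp_alg_scheme \<Rightarrow> 'a set" where
  "complemented A = {x \<in> carrier A. x \<curlyvee>\<^bsub>A\<^esub> neg_op A x = one_el A}"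

text \<open>The centre of the lattice in the sense of its complemented elements, not to be confused
  with the constant \<open>centre_el\<close>.\<close>

definition centre_alg :: "('a, 'm) dp_alg_scheme \<Rightarrow> 'a bool_alg" where
  "centre_alg A =
    \<lparr>carrier = complemented A, meet_op = meet_op A, join_op = join_op A,
     zero_el = zero_el A, one_el = one_el A, compl_op = neg_op A\<rparr>"

section \<open>Pseudocomplements and complemented elements\<close>

context dp_algebra
begin

lemma complemented_closed: "x \<in> complemented A \<Longrightarrow> x \<in> carrier A"
  by (simp add: complemented_def)

lemma neg_antimono:
  assumes "x \<preceq> y" "x \<in> carrier A" "y \<in> carrier A"
  shows "neg_op A y \<preceq> neg_op A x"
proof -
  have "x \<curlywedge> neg_op A y = x \<curlywedge> (y \<curlywedge> neg_op A y)"
    using assms by (metis le_op_def meet_assoc neg_closed)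
  then have "x \<curlywedge> neg_op A y = zero_el A"
    using assms by (simp add: meet_neg meet_zero)
  then show ?thesis
    using assms by (simp add: neg_greatest neg_closed)
qed

lemma le_neg_neg: "x \<in> carrier A \<Longrightarrow> x \<preceq> neg_op A (neg_op A x)"
  by (metis meet_comm meet_neg neg_closed neg_greatest)

lemma neg_neg_neg: "x \<in> carrier A \<Longrightarrow> neg_op A (neg_op A (neg_op A x)) = neg_op A x"
  by (simp add: le_antisym le_neg_neg neg_antimono neg_closed)

text \<open>The source of uniqueness of complements; later it also turns the contract condition on
  (a, b) into \<not>b \<le> a.\<close>

lemma le_if_disjoint_codisjoint:
  assumes "x \<in> carrier A" "y \<in> carrier A" "z \<in> carrier A"
    and "x \<curlywedge> y = zero_el A" "x \<curlyvee> z = one_el A"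
  shows "y \<preceq> z"
proof -
  have "y = y \<curlywedge> (x \<curlyvee> z)"
    using assms by (simp add: meet_one)
  also have "\<dots> = (y \<curlywedge> x) \<curlyvee> (y \<curlywedge> z)"
    using assms(1-3) by (intro meet_distrib)
  also have "\<dots> = y \<curlywedge> z"
    using assms by (metis meet_closed meet_comm zero_join)
  finally show ?thesis
    by (simp add: le_op_def)
qed

text \<open>By \<open>le_if_disjoint_codisjoint\<close>, a complement of x is both the greatest
  element disjoint from x and the least one joining with x to 1, so \<not> and D agree at x.\<close>

lemma complementedI:
  assumes "x \<in> carrier A" "y \<in> carrier A" "x \<curlywedge> y = zero_el A" "x \<curlyvee> y = one_el A"
  shows "x \<in> complemented A" "neg_op A x = y" "dual_neg_op A x = y"
proof -
  show neg: "neg_op A x = y"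
    using assms by (meson le_if_disjoint_codisjoint le_antisym meet_neg neg_closed neg_greatest)
  show "dual_neg_op A x = y"
    using assms by (meson le_if_disjoint_codisjoint dual_neg_closed dual_neg_least join_dual_neg le_antisym)
  show "x \<in> complemented A"
    using assms neg by (simp add: complemented_def)
qed

lemma complemented_neg:
  assumes "x \<in> complemented A"
  shows "neg_op A x \<in> complemented A" "neg_op A (neg_op A x) = x"
    "dual_neg_op A (neg_op A x) = x" "dual_neg_op A x = neg_op A x"
proof -
  have x: "x \<in> carrier A" "x \<curlyvee> neg_op A x = one_el A"
    using assms by (auto simp: complemented_def)
  have "neg_op A x \<curlywedge> x = zero_el A" "neg_op A x \<curlyvee> x = one_el A"
    using x by (metis meet_comm meet_neg neg_closed, metis join_comm neg_closed)
  then show "neg_op A x \<in> complemented A" "neg_op A (neg_op A x) = x"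
    "dual_neg_op A (neg_op A x) = x"
    using complementedI[of "neg_op A x" x] x by (auto simp: neg_closed)
  show "dual_neg_op A x = neg_op A x"
    using complementedI(3)[of x "neg_op A x"] x by (auto simp: neg_closed meet_neg)
qed

lemma zero_complemented: "zero_el A \<in> complemented A"
  and neg_zero: "neg_op A (zero_el A) = one_el A"
  and dual_neg_zero: "dual_neg_op A (zero_el A) = one_el A"
  using complementedI[of "zero_el A" "one_el A"]
  by (simp_all add: zero_closed one_closed zero_join meet_one)

lemma one_complemented: "one_el A \<in> complemented A"
  and neg_one: "neg_op A (one_el A) = zero_el A"
  and dual_neg_one: "dual_neg_op A (one_el A) = zero_el A"
  using complementedI[of "one_el A" "zero_el A"]
  by (simp_all add: zero_closed one_closed join_zero meet_zero)

lemma neg_join: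
  assumes "x \<in> carrier A" "y \<in> carrier A"
  shows "neg_op A (x \<curlyvee> y) = neg_op A x \<curlywedge> neg_op A y"
proof (rule le_antisym)
  let ?n = "neg_op A x \<curlywedge> neg_op A y"
  have n: "?n \<in> carrier A"
    using assms by (simp add: meet_closed neg_closed)
  show "neg_op A (x \<curlyvee> y) \<preceq> ?n"
    using assms by (simp add: join_closed join_ge1 join_ge2 le_meetI neg_antimono neg_closed)
  have "x \<curlywedge> ?n = zero_el A"
    using assms by (metis meet_assoc meet_comm meet_neg meet_zero neg_closed)
  moreover have "y \<curlywedge> ?n = zero_el A"
    using assms by (metis meet_assoc meet_comm meet_neg meet_zero neg_closed)
  ultimately have "(x \<curlyvee> y) \<curlywedge> ?n = zero_el A"
    using assms n by (metis join_closed meet_comm meet_distrib zero_closed zero_join)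
  then show "?n \<preceq> neg_op A (x \<curlyvee> y)"
    using assms n by (simp add: join_closed neg_greatest)
qed (use assms in \<open>simp_all add: join_closed meet_closed neg_closed\<close>)

end

section \<open>De Morgan laws, the Boolean centre and regularity\<close>

context three_valued_dp_algebra
begin

lemma neg_complemented: "x \<in> carrier A \<Longrightarrow> neg_op A x \<in> complemented A"
  by (simp add: complemented_def neg_closed stone)

lemma dual_neg_complemented: "x \<in> carrier A \<Longrightarrow> dual_neg_op A x \<in> complemented A"
  by (meson complementedI(1) dual_neg_closed dual_stone join_dual_neg)

text \<open>Unlike \<open>neg_join\<close>, this uses the Stone identity: \<not>(x \<and> y) is
  split along \<not>y \<or> \<not>\<not>y = 1. The piece under \<not>y is harmless, and the piece
  under \<not>\<not>y turns out to be disjoint from x.\<close>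

lemma neg_meet:
  assumes x: "x \<in> carrier A" and y: "y \<in> carrier A"
  shows "neg_op A (x \<curlywedge> y) = neg_op A x \<curlyvee> neg_op A y"
proof (rule le_antisym)
  define u where "u = neg_op A (x \<curlywedge> y)"
  define v where "v = neg_op A (neg_op A y)"
  have u: "u \<in> carrier A" and v: "v \<in> carrier A"
    and ny: "neg_op A y \<in> carrier A" and nx: "neg_op A x \<in> carrier A"
    using assms by (simp_all add: u_def v_def meet_closed neg_closed)
  \<comment> \<open>Being disjoint from y, the element u \<and> x lies below \<not>y and hence is
    disjoint from v = \<not>\<not>y.\<close>
  have "y \<curlywedge> (u \<curlywedge> x) = zero_el A"
    using x y u meet_neg[of "x \<curlywedge> y"] by (metis meet_assoc meet_closed meet_comm u_def)
  then have "u \<curlywedge> x \<preceq> neg_op A y"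
    using x y u by (simp add: meet_closed neg_greatest)
  then have "u \<curlywedge> x \<curlywedge> v = u \<curlywedge> x \<curlywedge> (neg_op A y \<curlywedge> v)"
    using x u v ny by (metis le_op_def meet_assoc meet_closed)
  then have "u \<curlywedge> x \<curlywedge> v = zero_el A"
    using x u ny by (simp add: v_def meet_neg meet_zero meet_closed)
  then have "x \<curlywedge> (u \<curlywedge> v) = zero_el A"
    using x u v by (metis meet_assoc meet_comm)
  then have uv: "u \<curlywedge> v \<preceq> neg_op A x"
    using x u v by (simp add: neg_greatest meet_closed)
  have "u = u \<curlywedge> (neg_op A y \<curlyvee> v)"
    using y u by (simp add: v_def stone meet_one)
  also have "\<dots> = (u \<curlywedge> neg_op A y) \<curlyvee> (u \<curlywedge> v)"
    using u v ny by (simp add: meet_distrib)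
  also have "\<dots> \<preceq> neg_op A x \<curlyvee> neg_op A y"
  proof (rule join_leI)
    show "u \<curlywedge> neg_op A y \<preceq> neg_op A x \<curlyvee> neg_op A y"
      by (rule le_trans[OF meet_le2 join_ge2])
        (use u nx ny in \<open>simp_all add: join_closed meet_closed\<close>)
    show "u \<curlywedge> v \<preceq> neg_op A x \<curlyvee> neg_op A y"
      by (rule le_trans[OF uv join_ge1])
        (use u v nx ny in \<open>simp_all add: join_closed meet_closed\<close>)
  qed (use u v nx ny in \<open>simp_all add: join_closed meet_closed\<close>)
  finally show "neg_op A (x \<curlywedge> y) \<preceq> neg_op A x \<curlyvee> neg_op A y"
    by (simp add: u_def)
  show "neg_op A x \<curlyvee> neg_op A y \<preceq> neg_op A (x \<curlywedge> y)"
    using assms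
    by (simp add: join_leI meet_closed meet_le1 meet_le2 neg_antimono neg_closed)
qed (use assms in \<open>simp_all add: join_closed meet_closed neg_closed\<close>)

text \<open>The axioms are self-dual as a whole: the two Stone identities trade places, and
  regularity becomes itself with a and b exchanged.\<close>

lemma three_valued_dual: "three_valued_dp_algebra (dual_alg A)"
proof -
  have le: "le_op (dual_alg A) x y \<longleftrightarrow> y \<preceq> x" if "x \<in> carrier A" "y \<in> carrier A" for x y
    using that by (metis dual_alg_def join_comm lattice_alg.simps(1) le_iff_join le_op_def)
  have fields: "carrier (dual_alg A) = carrier A" "meet_op (dual_alg A) = join_op A"
    "join_op (dual_alg A) = meet_op A" "zero_el (dual_alg A) = one_el A"
    "one_el (dual_alg A) = zero_el A" "neg_op (dual_alg A) = dual_neg_op A"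
    "dual_neg_op (dual_alg A) = neg_op A"
    by (simp_all add: dual_alg_def)
  show ?thesis
    by unfold_locales
      (simp_all add: fields le meet_closed join_closed zero_closed one_closed neg_closed
        dual_neg_closed meet_assoc join_assoc meet_absorb join_absorb join_distrib
        zero_least one_greatest join_dual_neg meet_neg dual_neg_least neg_greatest
        regular stone dual_stone, simp_all add: meet_comm join_comm)
qed

text \<open>This is \<open>neg_join\<close> read in the order dual; \<open>dual_neg_join\<close> is
  likewise \<open>neg_meet\<close> there.\<close>

lemma dual_neg_meet:
  "\<lbrakk>x \<in> carrier A; y \<in> carrier A\<rbrakk>
    \<Longrightarrow> dual_neg_op A (x \<curlywedge> y) = dual_neg_op A x \<curlyvee> dual_neg_op A y"
  using dp_algebra.neg_join[of "dual_alg A" x y] three_valued_dual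
  by (simp add: dual_alg_def three_valued_dp_algebra_def regular_dp_algebra_def)

lemma dual_neg_join:
  "\<lbrakk>x \<in> carrier A; y \<in> carrier A\<rbrakk>
    \<Longrightarrow> dual_neg_op A (x \<curlyvee> y) = dual_neg_op A x \<curlywedge> dual_neg_op A y"
  using three_valued_dp_algebra.neg_meet[OF three_valued_dual, of x y]
  by (simp add: dual_alg_def)

text \<open>Every value of \<not> is complemented, and x \<and> y = \<not>\<not>x \<and>
  \<not>\<not>y = \<not>(\<not>x \<or> \<not>y). The join is treated in the same way.\<close>

lemma complemented_meet:
  "\<lbrakk>x \<in> complemented A; y \<in> complemented A\<rbrakk> \<Longrightarrow> x \<curlywedge> y \<in> complemented A"
  by (metis complemented_closed complemented_neg(2) join_closed neg_closed neg_complemented neg_join)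

lemma complemented_join:
  "\<lbrakk>x \<in> complemented A; y \<in> complemented A\<rbrakk> \<Longrightarrow> x \<curlyvee> y \<in> complemented A"
  by (metis complemented_closed complemented_neg(2) meet_closed neg_closed neg_complemented neg_meet)

lemma boolean_centre: "boolean_alg (centre_alg A)"
  by unfold_locales
    (auto simp: centre_alg_def le_op_def complemented_meet complemented_join zero_complemented
      one_complemented complemented_neg meet_neg meet_assoc join_assoc meet_absorb join_absorb
      meet_distrib meet_one complemented_closed
      intro: meet_comm join_comm zero_least[unfolded le_op_def],
      auto simp: complemented_def)

text \<open>Meeting x with y \<or> Dy = 1 gives x = (x \<and> y) \<or> (x \<and> Dx). Regularity
  puts x \<and> Dx below x \<and> (y \<or> \<not>y) = x \<and> (y \<or> \<not>x) = x \<and>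
  y.\<close>

lemma le_by_regularity:
  assumes x: "x \<in> carrier A" and y: "y \<in> carrier A"
    and D: "dual_neg_op A x = dual_neg_op A y" and N: "neg_op A x = neg_op A y"
  shows "x \<preceq> y"
proof -
  let ?d = "x \<curlywedge> dual_neg_op A x"
  have d: "?d \<in> carrier A"
    using x by (simp add: meet_closed dual_neg_closed)
  have "?d \<preceq> x \<curlywedge> (y \<curlyvee> neg_op A x)"
    using x y d regular[OF x y] N
    by (simp add: le_meetI meet_le1 dual_neg_closed join_closed neg_closed)
  also have "x \<curlywedge> (y \<curlyvee> neg_op A x) = x \<curlywedge> y"
    using x y by (simp add: meet_distrib meet_neg neg_closed join_zero meet_closed)
  finally have "?d \<preceq> x \<curlywedge> y" .
  moreover have "x = (x \<curlywedge> y) \<curlyvee> ?d"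
    using x y D by (metis dual_neg_closed join_dual_neg meet_distrib meet_one)
  ultimately have "x = x \<curlywedge> y"
    using x y d by (metis join_comm le_iff_join meet_closed)
  then show ?thesis
    by (simp add: le_op_def)
qed

lemma regular_determined:
  assumes "x \<in> carrier A" "y \<in> carrier A"
    and "dual_neg_op A x = dual_neg_op A y" "neg_op A (neg_op A x) = neg_op A (neg_op A y)"
  shows "x = y"
proof -
  have "neg_op A x = neg_op A y"
    using assms by (metis neg_neg_neg)
  then show ?thesis
    using assms by (simp add: le_antisym le_by_regularity)
qed

text \<open>The contract condition for (Dx, \<not>\<not>x). It follows from Dx \<or> x = 1 because x
  \<le> \<not>\<not>x.\<close>

lemma dual_neg_join_neg_neg:
  assumes "x \<in> carrier A"
  shows "dual_neg_op A x \<curlyvee> neg_op A (neg_op A x) = one_el A"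
proof -
  have "dual_neg_op A x \<curlyvee> (x \<curlyvee> neg_op A (neg_op A x))
      = one_el A \<curlyvee> neg_op A (neg_op A x)"
    using assms by (metis dual_neg_closed join_assoc join_comm join_dual_neg neg_closed)
  then show ?thesis
    using assms le_neg_neg[OF assms]
    by (metis join_comm join_one le_iff_join neg_closed one_closed)
qed

end

section \<open>Contracts as images, and the isomorphism\<close>

context c3dp_algebra
begin

lemma contract_preimage:
  assumes a: "a \<in> complemented A" and b: "b \<in> complemented A" and ab: "a \<curlyvee> b = one_el A"
  defines "x \<equiv> b \<curlywedge> (neg_op A a \<curlyvee> centre_el A)"
  shows "x \<in> carrier A" "dual_neg_op A x = a" "neg_op A (neg_op A x) = b"
proof -
  have ca: "a \<in> carrier A" "neg_op A a \<in> carrier A"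
    and cb: "b \<in> carrier A" "neg_op A b \<in> carrier A"
    and c: "neg_op A a \<curlyvee> centre_el A \<in> carrier A"
    using a b by (simp_all add: complemented_closed neg_closed join_closed centre_closed)
  show "x \<in> carrier A"
    using cb c by (simp add: x_def meet_closed)
  \<comment> \<open>Expanding gives Dx = Db \<or> (D\<not>a \<and> Dc) = \<not>b \<or> a, and the
    contract condition absorbs \<not>b into a.\<close>
  have "neg_op A b \<preceq> a"
    using ca cb ab by (metis le_if_disjoint_codisjoint join_comm meet_neg)
  then have "neg_op A b \<curlyvee> a = a"
    using ca cb by (simp add: le_iff_join)
  then show "dual_neg_op A x = a"
    using ca cb c a b
    by (simp add: x_def dual_neg_meet dual_neg_join centre_closed complemented_neg
        dual_neg_centre meet_one)
  \<comment> \<open>Here \<not>x = \<not>b \<or> (\<not>\<not>a \<and> \<not>c), and \<not>c = 0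
    removes the second term.\<close>
  have "neg_op A x = neg_op A b"
    using ca cb c a
    by (simp add: x_def neg_meet neg_join centre_closed neg_centre complemented_neg
        meet_zero join_zero)
  then show "neg_op A (neg_op A x) = b"
    using b by (simp add: complemented_neg)
qed

lemma contract_iso:
  "(\<lambda>x. (dual_neg_op A x, neg_op A (neg_op A x)))
    \<in> c3dp_iso A (contract_algebra (centre_alg A))" (is "?h \<in> _")
proof -
  let ?C = "carrier (contract_algebra (centre_alg A))"
  have C: "?C = {(a, b). a \<in> complemented A \<and> b \<in> complemented A \<and> a \<curlyvee> b = one_el A}"
    by (simp add: contract_algebra_def centre_alg_def)
  have "bij_betw ?h (carrier A) ?C"
  proof (rule bij_betw_imageI)
    show "inj_on ?h (carrier A)"
      by (rule inj_onI) (auto intro: regular_determined)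
    have "p \<in> ?h ` carrier A" if p_in: "p \<in> ?C" for p
    proof -
      obtain a b where p: "p = (a, b)" and ab: "a \<in> complemented A" "b \<in> complemented A"
        "a \<curlyvee> b = one_el A"
        using p_in unfolding C by auto
      show ?thesis
        unfolding p using contract_preimage[OF ab] by (intro image_eqI) simp_all
    qed
    moreover have "?h x \<in> ?C" if "x \<in> carrier A" for x
      using that unfolding C
      by (simp add: dual_neg_complemented neg_complemented neg_closed dual_neg_join_neg_neg)
    ultimately show "?h ` carrier A = ?C"
      by blast
  qed
  \<comment> \<open>The De Morgan laws handle meets and joins, including the order reversal in the
    first component. The two negations are preserved because \<not>x and Dx are complemented:
    D\<not>x = \<not>\<not>x, DDx = \<not>Dx and \<not>\<not>Dx = Dx.\<close>
  then show ?thesis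
    by (simp add: c3dp_iso_def, simp add: contract_algebra_def centre_alg_def dual_neg_meet
        dual_neg_join neg_meet neg_join neg_closed dual_neg_closed complemented_neg
        neg_complemented dual_neg_complemented neg_zero neg_one dual_neg_zero
        dual_neg_one neg_centre dual_neg_centre)
qed

end

theorem corollary4p2:
  fixes A :: "'a c3dp_alg"
  assumes "c3dp_algebra A"
  shows "\<exists>B :: 'a bool_alg. boolean_alg B \<and> c3dp_isomorphic A (contract_algebra B)"
proof -
  interpret c3dp_algebra A
    by (rule assms)
  show ?thesis
    using boolean_centre contract_iso unfolding c3dp_isomorphic_def by blast
qed

end
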